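(* Let $B=\begin{bmatrix}0&2&-2\\-2&0&2\\2&-2&0\end{bmatrix}$ be the adjacency matrix of the Markov quiver, and let $\mu=(\mu_{k_j})_{j=1}^\infty$ be the sequence of mutations with $(k_j)_{j\ge1}=(1,2,3,1,2,3,\dots)$. Then there exists a sequence $\sigma_{\mathrm{reg}}=(\sigma_{\mathrm{reg}}^{(n)})_{n=0}^\infty$ of strict sign vectors $\sigma_{\mathrm{reg}}^{(n)}\in\{+,-\}^3$ such that for every nonzero $\mathbf a\in\mathbb Z^3$ there is $T\in\mathbb N$ with $\sigma_\mu^{(n)}(\mathbf a)=\sigma_{\mathrm{reg}}^{(n)}$ for all $n>T$.
   Context: **Matrix mutation.** Let $\hat B=(b_{ij})$ be an integer $(N+1)\times N$ matrix whose top $N\times N$ part is skew-symmetric. For $k\in\{1,\dots,N\}$, the mutation $\hat B'=\mu_k(\hat B)$ has entries $b'_{ij}=-b_{ij}$ if $i=k$ or $j=k$, and $b'_{ij}=b_{ij}+[-\varepsilon b_{ik}]_+b_{kj}+b_{ik}[\varepsilon b_{kj}]_+$ otherwise, where $[a]_+=\max(a,0)$ and $\varepsilon\in\{1,-1\}$ (the result does not depend on $\varepsilon$). Here $N=3$. **Sign vectors.** For an integer $a$, $\mathrm{sign}(a)\in\{+,0,-\}$ is its sign. A sign vector is strict if it has no entry $0$. For $\mathbf a\in\mathbb Z^3$, let $\hat B$ be the $4\times3$ matrix obtained by appending $\mathbf a$ to $B$ as the last row, let $\mu^{(n)}=\mu_{k_n}\circ\cdots\circ\mu_{k_1}$ (with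 $\mu^{(0)}=\mathrm{id}$), and let $\mathbf a^{(n)}=(a_1^{(n)},a_2^{(n)},a_3^{(n)})$ be the last row of $\mu^{(n)}(\hat B)$. Then $\sigma_\mu^{(n)}(\mathbf a)=(\mathrm{sign}(a_1^{(n)}),\mathrm{sign}(a_2^{(n)}),\mathrm{sign}(a_3^{(n)}))$. *)

theory Defs
  imports "Jordan_Normal_Form.Matrix"
begin

(* Rows and columns of the library matrices are numbered from 0, so a mutation direction
   k in {1,...,N} of the mathematical text is the index k - 1 here. *)

definition pos_part :: "int \<Rightarrow> int" where
  "pos_part a = max a 0"

definition mutation_eps :: "int \<Rightarrow> nat \<Rightarrow> int mat \<Rightarrow> int mat" where
  "mutation_eps \<epsilon> k B = mat (dim_row B) (dim_col B) (\<lambda>(i, j).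
     if i = k \<or> j = k then - (B $$ (i, j))
     else B $$ (i, j) + pos_part (- \<epsilon> * B $$ (i, k)) * B $$ (k, j)
                      + B $$ (i, k) * pos_part (\<epsilon> * B $$ (k, j)))"

definition mutation :: "nat \<Rightarrow> int mat \<Rightarrow> int mat" where
  "mutation = mutation_eps 1"

lemma mutation_eps_eq_mutation:
  assumes "\<epsilon> \<in> {1, -1}"
  shows "mutation_eps \<epsilon> k B = mutation k B"
proof -
  have "pos_part x * y + x * pos_part (- y) = pos_part (- x) * y + x * pos_part y" for x y
    by (auto simp: pos_part_def max_def)
  then show ?thesis
    using assms by (auto simp: mutation_def mutation_eps_def add.assoc intro!: eq_matI)
qed

(* ks j is the direction k_j for j >= 1; the value ks 0 is never used. *)
fun iterated_mutation :: "(nat \<Rightarrow> nat) \<Rightarrow> nat \<Rightarrow> int mat \<Rightarrow> int mat" where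
  "iterated_mutation ks 0 B = B"
| "iterated_mutation ks (Suc n) B = mutation (ks (Suc n)) (iterated_mutation ks n B)"

definition last_row :: "int mat \<Rightarrow> int vec" where
  "last_row M = row M (dim_row M - 1)"

(* The signs +, 0, - are the integers 1, 0, -1, as returned by sgn. *)
definition sign_vector :: "int mat \<Rightarrow> (nat \<Rightarrow> nat) \<Rightarrow> nat \<Rightarrow> int vec \<Rightarrow> int vec" where
  "sign_vector B ks n a = map_vec sgn (last_row (iterated_mutation ks n (B @\<^sub>r mat_of_row a)))"

definition strict_sign_vectors :: "nat \<Rightarrow> int vec set" where
  "strict_sign_vectors N = {s \<in> carrier_vec N. \<forall>i<N. s $ i \<in> {1, -1}}"

definition markov_matrix :: "int mat" where
  "markov_matrix = mat_of_rows_list 3 [[0, 2, -2], [-2, 0, 2], [2, -2, 0]]"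

(* The directions 1,2,3,1,2,3,... for j = 1,2,3,4,5,6,..., shifted to start from 0. *)
definition cyclic_directions :: "nat \<Rightarrow> nat" where
  "cyclic_directions j = (j - 1) mod 3"

end

theory Submission
  imports Defs
begin

text \<open>
  Every mutation of the Markov matrix only negates it, so the signs alternate and the directions
  rotate. Both effects disappear when the last row after \<open>n\<close> steps is read cyclically from
  position \<open>n mod 3\<close> and multiplied by \<open>(-1)^n\<close>: it then evolves under one fixed piecewise
  linear map, \<open>markov_flow\<close> below, on triples \<open>(x, y, z)\<close>. Eliminating \<open>y\<close> and \<open>z\<close> leaves the
  recurrence

    \<open>x (n + 3) = x n - 2 [- x (n + 1)]\<^sub>+ - 2 [x (n + 2)]\<^sub>+\<close>,

  so \<open>x\<close> is non-increasing along each residue class modulo 3. This monotonicity decides everything.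

  If some residue class stays non-negative, then it is eventually constant, being a descending
  sequence of integers. Equality in the recurrence forces the next class to be non-negative and
  the one after it to be non-positive. Going round, all three classes are both, so \<open>x\<close> is
  eventually zero; since the map is injective at the origin, the initial vector is zero
  (\<open>nonneg_class_imp_zero\<close>). Hence for a nonzero vector all three classes become negative
  (\<open>markov_flow_eventually_neg\<close>), and then \<open>x < 0\<close>, \<open>y > 0\<close>, \<open>z < 0\<close> from some step on. The
  pattern \<open>(-, +, -)\<close>, rotated and alternated back, is the universal strict sign vector.
\<close>

section \<open>The dynamics of the last row\<close>

lemma nonneg_antimono_int_eventually_const:
  fixes d :: "nat \<Rightarrow> int"
  assumes dec: "\<And>n. d (Suc n) \<le> d n" and nonneg: "\<And>n. 0 \<le> d n"
  shows "\<exists>N. \<forall>n\<ge>N. d n = d N"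
proof -
  obtain N where N: "\<And>n. nat (d N) \<le> nat (d n)"
    using ex_has_least_nat[of "\<lambda>_. True" _ "\<lambda>n. nat (d n)"] by auto
  have "d n = d N" if "n \<ge> N" for n
  proof (rule antisym)
    show "d n \<le> d N"
      using lift_Suc_antimono_le[of d, OF dec that] .
    show "d N \<le> d n"
      using N[of n] nonneg[of n] by (simp add: nat_le_iff)
  qed
  then show ?thesis by blast
qed

text \<open>
  In a triple \<open>(x, y, z)\<close> the entry mutated next comes first; a step rotates the triple and
  changes all signs, so \<open>z\<close> merely remembers the previous \<open>x\<close>.
\<close>

locale markov_flow =
  fixes x y z :: "nat \<Rightarrow> int"
  assumes x_Suc: "x (Suc n) = - y n - 2 * pos_part (x n)"
    and y_Suc: "y (Suc n) = - z n + 2 * pos_part (- x n)"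
    and z_Suc: "z (Suc n) = x n"
begin

lemma x_recurrence:
  "x (n + 3) = x n - 2 * pos_part (- x (n + 1)) - 2 * pos_part (x (n + 2))"
  using x_Suc[of "Suc (Suc n)"] y_Suc[of "Suc n"] z_Suc[of n]
  by (simp add: eval_nat_numeral)

lemma class_antimono:
  assumes "j \<le> k"
  shows "x (n + 3 * k) \<le> x (n + 3 * j)"
proof (rule lift_Suc_antimono_le[of "\<lambda>k. x (n + 3 * k)", OF _ assms])
  show "x (n + 3 * Suc i) \<le> x (n + 3 * i)" for i
    using x_recurrence[of "n + 3 * i"] by (simp add: pos_part_def algebra_simps)
qed

text \<open>
  A constant stretch of one class means that both subtracted terms of the recurrence vanish, and
  these terms control the signs of the other two classes.
\<close>

lemma nonneg_class_next_signs:
  assumes "\<And>k. 0 \<le> x (n + 3 * k)"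
  shows "\<exists>N. \<forall>k\<ge>N. 0 \<le> x (n + 1 + 3 * k) \<and> x (n + 2 + 3 * k) \<le> 0"
proof -
  obtain N where N: "\<And>k. k \<ge> N \<Longrightarrow> x (n + 3 * k) = x (n + 3 * N)"
    using nonneg_antimono_int_eventually_const[of "\<lambda>k. x (n + 3 * k)"] assms
      class_antimono[of _ "Suc _" n] by (meson le_SucI order_refl)
  have "0 \<le> x (n + 1 + 3 * k) \<and> x (n + 2 + 3 * k) \<le> 0" if "k \<ge> N" for k
  proof -
    have "x (n + 3 * k + 3) = x (n + 3 * k)"
      using N[of k] N[of "Suc k"] that by (simp add: algebra_simps)
    then show ?thesis
      using x_recurrence[of "n + 3 * k"]
      by (simp add: pos_part_def max_def algebra_simps split: if_splits)
  qed
  then show ?thesis by blast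
qed

text \<open>
  The sign obtained eventually holds from the start because the class only descends; this is what
  allows the previous argument to be repeated on the next class.
\<close>

lemma nonneg_class_Suc:
  assumes "\<And>k. 0 \<le> x (n + 3 * k)"
  shows "0 \<le> x (n + 1 + 3 * k)"
proof -
  obtain N where "\<And>k. k \<ge> N \<Longrightarrow> 0 \<le> x (n + 1 + 3 * k)"
    using nonneg_class_next_signs[OF assms] by blast
  then have "0 \<le> x (n + 1 + 3 * max N k)" by simp
  then show ?thesis
    using class_antimono[of k "max N k" "n + 1"] by simp
qed

text \<open>The map can be run backwards from the origin, where it is determined uniquely.\<close>

lemma zero_backwards:
  assumes "x n = 0" "y n = 0" "z n = 0"
  shows "x 0 = 0 \<and> y 0 = 0 \<and> z 0 = 0"
  using assms
proof (induction n)
  case (Suc n)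
  then show ?case
    using x_Suc[of n] y_Suc[of n] z_Suc[of n] by (simp add: pos_part_def)
qed simp

lemma nonneg_class_imp_zero:
  assumes class0: "\<And>k. 0 \<le> x (n + 3 * k)"
  shows "x 0 = 0 \<and> y 0 = 0 \<and> z 0 = 0"
proof -
  have class1: "\<And>k. 0 \<le> x (n + 1 + 3 * k)"
    using nonneg_class_Suc[OF class0] .
  have class2: "\<And>k. 0 \<le> x (n + 2 + 3 * k)"
    using nonneg_class_Suc[OF class1] by simp
  obtain N0 where N0: "\<And>k. k \<ge> N0 \<Longrightarrow> x (n + 2 + 3 * k) \<le> 0"
    using nonneg_class_next_signs[OF class0] by blast
  obtain N1 where N1: "\<And>k. k \<ge> N1 \<Longrightarrow> x (n + 1 + 2 + 3 * k) \<le> 0"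
    using nonneg_class_next_signs[OF class1] by blast
  obtain N2 where N2: "\<And>k. k \<ge> N2 \<Longrightarrow> x (n + 2 + 2 + 3 * k) \<le> 0"
    using nonneg_class_next_signs[OF class2] by blast
  define K where "K = N0 + N1 + N2"
  \<comment> \<open>Three consecutive zeros of \<open>x\<close>, one from each class, determine a zero triple.\<close>
  define m where "m = n + 2 + 3 * K"
  have "x m = 0"
    using N0[of K] class2[of K] by (simp add: K_def m_def)
  moreover have "x (Suc m) = 0"
    using N1[of K] class0[of "Suc K"] by (simp add: K_def m_def algebra_simps eval_nat_numeral)
  moreover have "x (Suc (Suc m)) = 0"
    using N2[of K] class1[of "Suc K"] by (simp add: K_def m_def algebra_simps eval_nat_numeral)
  ultimately have "y m = 0 \<and> z m = 0"
    using x_Suc[of m] x_Suc[of "Suc m"] y_Suc[of m] by (simp add: pos_part_def)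
  with \<open>x m = 0\<close> show ?thesis
    using zero_backwards by blast
qed

lemma markov_flow_eventually_neg:
  assumes "\<not> (x 0 = 0 \<and> y 0 = 0 \<and> z 0 = 0)"
  shows "\<exists>T. \<forall>n\<ge>T. x n < 0"
proof -
  have "\<exists>K. x (r + 3 * K) < 0" for r
    using nonneg_class_imp_zero[of r] assms by (meson not_less)
  then obtain K where K: "\<And>r. x (r + 3 * K r) < 0"
    by metis
  have "x n < 0" if "n \<ge> 3 + 3 * (K 0 + K 1 + K 2)" for n
  proof -
    have "n mod 3 \<in> {0, 1, 2}" by auto
    then have "K (n mod 3) \<le> n div 3"
      using that by auto
    then have "x (n mod 3 + 3 * (n div 3)) \<le> x (n mod 3 + 3 * K (n mod 3))"
      by (rule class_antimono)
    then show ?thesis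
      using K[of "n mod 3"] by simp
  qed
  then show ?thesis by blast
qed

lemma markov_flow_eventual_signs:
  assumes "\<not> (x 0 = 0 \<and> y 0 = 0 \<and> z 0 = 0)"
  shows "\<exists>T. \<forall>n>T. x n < 0 \<and> 0 < y n \<and> z n < 0"
proof -
  obtain T where T: "\<And>n. n \<ge> T \<Longrightarrow> x n < 0"
    using markov_flow_eventually_neg[OF assms] by blast
  have "x n < 0 \<and> 0 < y n \<and> z n < 0" if "n > T" for n
  proof -
    obtain m where m: "n = Suc m" using \<open>n > T\<close> by (cases n) auto
    show ?thesis
      using T[of m] T[of n] T[of "Suc n"] x_Suc[of n] z_Suc[of m] that
      by (simp add: m pos_part_def)
  qed
  then show ?thesis by blast
qed

end

section \<open>Mutations of the extended Markov matrix\<close>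

definition markov_mutant :: "int vec \<Rightarrow> nat \<Rightarrow> int mat" where
  "markov_mutant a n = iterated_mutation cyclic_directions n (markov_matrix @\<^sub>r mat_of_row a)"

lemma markov_mutant_dim:
  assumes "a \<in> carrier_vec 3"
  shows "dim_row (markov_mutant a n) = 4" "dim_col (markov_mutant a n) = 3"
  using assms
  by (induction n)
    (auto simp: markov_mutant_def mutation_def mutation_eps_def append_rows_def markov_matrix_def
       mat_of_rows_list_def)

lemma markov_mutant_Suc:
  assumes a: "a \<in> carrier_vec 3" and "i < 4" "j < 3"
  shows "markov_mutant a (Suc n) $$ (i, j) =
    (let M = markov_mutant a n; k = n mod 3 in
     if i = k \<or> j = k then - (M $$ (i, j))
     else M $$ (i, j) + pos_part (- M $$ (i, k)) * M $$ (k, j)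
                      + M $$ (i, k) * pos_part (M $$ (k, j)))"
  using assms markov_mutant_dim[OF a, of n]
  by (simp add: markov_mutant_def mutation_def mutation_eps_def cyclic_directions_def Let_def)

lemma markov_matrix_index:
  assumes "i < 3" "j < 3"
  shows "markov_matrix $$ (i, j) =
    (if j = (i + 1) mod 3 then 2 else if j = (i + 2) mod 3 then - 2 else 0)"
proof -
  have "i \<in> {0, 1, 2}" "j \<in> {0, 1, 2}" using assms by auto
  then show ?thesis
    by (elim insertE emptyE) (simp_all add: markov_matrix_def mat_of_rows_list_def)
qed

lemma markov_mutant_top:
  assumes a: "a \<in> carrier_vec 3" and "i < 3" "j < 3"
  shows "markov_mutant a n $$ (i, j) = (-1) ^ n * markov_matrix $$ (i, j)"
  using assms(2,3)
proof (induction n arbitrary: i j)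
  case 0
  then show ?case
    using a by (simp add: markov_mutant_def append_rows_def markov_matrix_def mat_of_rows_list_def)
next
  case (Suc n)
  define k where "k = n mod 3"
  define c :: int where "c = (-1) ^ n"
  have c: "c \<in> {1, -1}"
    unfolding c_def by (cases "even n") simp_all
  have "k < 3" by (simp add: k_def)
  have step: "markov_mutant a (Suc n) $$ (i, j) =
    (let b = \<lambda>i j. c * markov_matrix $$ (i, j) in
     if i = k \<or> j = k then - b i j
     else b i j + pos_part (- b i k) * b k j + b i k * pos_part (b k j))"
    using Suc.prems \<open>k < 3\<close>
    by (simp add: markov_mutant_Suc[OF a] Let_def c_def Suc.IH flip: k_def)
  have "i \<in> {0, 1, 2}" "j \<in> {0, 1, 2}" "k \<in> {0, 1, 2}"
    using Suc.prems \<open>k < 3\<close> by auto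
  then have "markov_mutant a (Suc n) $$ (i, j) = - c * markov_matrix $$ (i, j)"
    unfolding step using c
    by (elim insertE emptyE) (simp_all add: markov_matrix_index pos_part_def)
  then show ?case
    by (simp add: c_def)
qed

text \<open>
  The index \<open>n + i\<close> puts the direction mutated next first, and the sign \<open>(-1)^n\<close> cancels the
  alternation of the upper part, so that the evolution no longer depends on \<open>n\<close>.
\<close>

definition rotated_row :: "int vec \<Rightarrow> nat \<Rightarrow> nat \<Rightarrow> int" where
  "rotated_row a i n = (-1) ^ n * markov_mutant a n $$ (3, (n + i) mod 3)"

lemma rotated_row_markov_flow:
  assumes a: "a \<in> carrier_vec 3"
  shows "markov_flow (rotated_row a 0) (rotated_row a 1) (rotated_row a 2)"
proof
  fix n
  have shift: "Suc (Suc n) mod 3 = (n + 2) mod 3" "(Suc n + 2) mod 3 = n mod 3"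
    by presburger+
  have distinct: "Suc n mod 3 \<noteq> n mod 3" "(n + 2) mod 3 \<noteq> n mod 3" "(n + 2) mod 3 \<noteq> Suc n mod 3"
    by presburger+
  have "markov_matrix $$ (n mod 3, Suc n mod 3) = 2"
    by (simp add: markov_matrix_index mod_simps)
  moreover have "markov_matrix $$ (n mod 3, (n + 2) mod 3) = - 2"
    using distinct(3) by (simp add: markov_matrix_index mod_simps)
  ultimately have top: "markov_mutant a n $$ (n mod 3, Suc n mod 3) = (-1) ^ n * 2"
    "markov_mutant a n $$ (n mod 3, (n + 2) mod 3) = (-1) ^ n * - 2"
    by (simp_all add: markov_mutant_top[OF a])
  have "n mod 3 \<noteq> 3" using mod_less_divisor[of 3 n] by linarith
  note step = markov_mutant_Suc[OF a, of 3 _ n, unfolded Let_def] this distinct top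
  define c :: int where "c = (-1) ^ n"
  define p where "p = markov_mutant a n $$ (3, n mod 3)"
  define q where "q = markov_mutant a n $$ (3, Suc n mod 3)"
  define r where "r = markov_mutant a n $$ (3, (n + 2) mod 3)"
  have c: "c \<in> {1, -1}"
    unfolding c_def by (cases "even n") simp_all
  have p': "markov_mutant a (Suc n) $$ (3, n mod 3) = - p"
    by (simp add: step p_def)
  have q': "markov_mutant a (Suc n) $$ (3, Suc n mod 3)
      = q + pos_part (- p) * (c * 2) + p * pos_part (c * 2)"
    by (simp add: step p_def q_def c_def)
  have r': "markov_mutant a (Suc n) $$ (3, (n + 2) mod 3)
      = r + pos_part (- p) * (c * - 2) + p * pos_part (c * - 2)"
    by (simp add: step p_def r_def c_def del: add_2_eq_Suc')
  have rows: "rotated_row a 0 n = c * p" "rotated_row a 1 n = c * q" "rotated_row a 2 n = c * r"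
    by (simp_all add: rotated_row_def c_def p_def q_def r_def)
  have Suc_rows: "rotated_row a 0 (Suc n) = - c * markov_mutant a (Suc n) $$ (3, Suc n mod 3)"
    "rotated_row a 1 (Suc n) = - c * markov_mutant a (Suc n) $$ (3, (n + 2) mod 3)"
    "rotated_row a 2 (Suc n) = - c * markov_mutant a (Suc n) $$ (3, n mod 3)"
    by (simp_all only: rotated_row_def c_def shift power_Suc add_0_right
        Suc_eq_plus1[symmetric] mult_minus1 mult_minus_left mult_1)
  show "rotated_row a 0 (Suc n) = - rotated_row a 1 n - 2 * pos_part (rotated_row a 0 n)"
    unfolding rows Suc_rows q' using c by (auto simp: pos_part_def)
  show "rotated_row a 1 (Suc n) = - rotated_row a 2 n + 2 * pos_part (- rotated_row a 0 n)"
    unfolding rows Suc_rows r' using c by (auto simp: pos_part_def)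
  show "rotated_row a 2 (Suc n) = rotated_row a 0 n"
    unfolding rows Suc_rows p' by simp
qed

lemma rotated_row_0_nonzero:
  assumes a: "a \<in> carrier_vec 3" and "a \<noteq> 0\<^sub>v 3"
  shows "\<not> (rotated_row a 0 0 = 0 \<and> rotated_row a 1 0 = 0 \<and> rotated_row a 2 0 = 0)"
proof -
  have row: "rotated_row a i 0 = a $ i" if "i < 3" for i
    using a that
    by (simp add: rotated_row_def markov_mutant_def append_rows_def markov_matrix_def
        mat_of_rows_list_def)
  obtain i where "i < 3" "a $ i \<noteq> 0"
    using assms by (metis carrier_vecD eq_vecI index_zero_vec)
  moreover from this have "i \<in> {0, 1, 2}" by auto
  ultimately show ?thesis
    using row by auto
qed

lemma sign_vector_markov_index:
  assumes a: "a \<in> carrier_vec 3" and "i < 3"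
  shows "sign_vector markov_matrix cyclic_directions n a $ ((n + i) mod 3)
    = (-1) ^ n * sgn (rotated_row a i n)"
  using markov_mutant_dim[OF a, of n]
  by (cases "even n")
    (simp_all add: sign_vector_def last_row_def rotated_row_def markov_mutant_def)

section \<open>Universal eventual signs\<close>

definition regular_signs :: "nat \<Rightarrow> int vec" where
  "regular_signs n = vec 3 (\<lambda>j. (-1) ^ n * (if j = (n + 1) mod 3 then 1 else - 1))"

lemma regular_signs_strict: "regular_signs n \<in> strict_sign_vectors 3"
  by (cases "even n") (auto simp: regular_signs_def strict_sign_vectors_def)

lemma sign_vector_markov_eq_regular_signs:
  assumes a: "a \<in> carrier_vec 3"
    and signs: "rotated_row a 0 n < 0" "0 < rotated_row a 1 n" "rotated_row a 2 n < 0"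
  shows "sign_vector markov_matrix cyclic_directions n a = regular_signs n"
proof (rule eq_vecI)
  show "dim_vec (sign_vector markov_matrix cyclic_directions n a) = dim_vec (regular_signs n)"
    using markov_mutant_dim[OF a, of n]
    by (simp add: sign_vector_def last_row_def regular_signs_def markov_mutant_def)
  fix j
  assume "j < dim_vec (regular_signs n)"
  then have j: "j < 3" by (simp add: regular_signs_def)
  then have "\<exists>i<3. j = (n + i) mod 3" by presburger
  then obtain i where i: "i < 3" "j = (n + i) mod 3" by blast
  moreover have "i \<in> {0, 1, 2}" using i by auto
  moreover have "n mod 3 \<noteq> (n + 1) mod 3" "(n + 2) mod 3 \<noteq> (n + 1) mod 3"
    by presburger+
  ultimately show "sign_vector markov_matrix cyclic_directions n a $ j = regular_signs n $ j"
    using signs sign_vector_markov_index[OF a, of i n] j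
    by (auto simp: regular_signs_def)
qed

theorem mainTheorem2:
  shows "\<exists>\<sigma> :: nat \<Rightarrow> int vec.
    (\<forall>n. \<sigma> n \<in> strict_sign_vectors 3) \<and>
    (\<forall>a \<in> carrier_vec 3. a \<noteq> 0\<^sub>v 3 \<longrightarrow>
      (\<exists>T::nat. \<forall>n>T. sign_vector markov_matrix cyclic_directions n a = \<sigma> n))"
proof (intro exI[of _ regular_signs] conjI allI ballI impI)
  show "regular_signs n \<in> strict_sign_vectors 3" for n
    by (rule regular_signs_strict)
  fix a :: "int vec"
  assume a: "a \<in> carrier_vec 3" and nonzero: "a \<noteq> 0\<^sub>v 3"
  from markov_flow.markov_flow_eventual_signs[OF rotated_row_markov_flow[OF a]
      rotated_row_0_nonzero[OF a nonzero]]
  show "\<exists>T::nat. \<forall>n>T. sign_vector markov_matrix cyclic_directions n a = regular_signs n"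
    using sign_vector_markov_eq_regular_signs[OF a] by blast
qed

end
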